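(* Let $\mathbf{f}(\mathbf{p})=\sum_{x\in\mathcal{D}}\mathbf{g}(\mathbf{p}_x)$ be a separable symmetric property on a finite domain $\mathcal{D}$, let $\mathrm{G}\subseteq\mathcal{D}$, $\mathrm{F},\mathrm{F}'\subseteq\mathbb{Z}_+$, $\epsilon>0$, $\delta,\gamma\ge0$, $0<\beta\le1$. Suppose that for every $S'\subseteq\mathrm{G}$ there exists an estimator $\hat{\mathbf{f}}:\Phi_{S'}^n\to\mathbb{R}$ such that for every $\mathbf{p}\in\Delta^{\mathcal{D}}$, if $\phi_{S'}$ is the $S'$-pseudo profile of $n$ i.i.d. samples from $\mathbf{p}$, then $$\Pr[|\mathbf{f}_{S'}(\mathbf{p})-\hat{\mathbf{f}}(\phi_{S'})|\ge2\epsilon]\le\delta\quad\text{and}\quad\Pr[\mathrm{Freq}(\phi_{S'})\not\subseteq\mathrm{F}']\le\gamma.$$ Let $x^{2n}=(x_1^n,x_2^n)$ be $2n$ i.i.d. samples from $\mathbf{p}$, where $x_1^n$ and $x_2^n$ are the first and last $n$ samples, let $S=\{y\in\mathcal{D}:\mathbf{f}(x_1^n,y)\in\mathrm{F}\}$ (a random set), $\phi_S=\Phi_S(x_2^n)$, and let $\mathbf{p}^\beta_{\phi_S}$ be a $(\beta,S)$-approximate pseudo PML distribution for $\phi_S$. Then $$\Pr\big[|\mathbf{f}_S(\mathbf{p})-\mathbf{f}_S(\mathbf{p}^\beta_{\phi_S})|>4\epsilon\big]\le\frac{\delta(n+1)^{|\mathrm{F}'|}}{\beta}+\gamma+\Pr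[S\not\subseteq\mathrm{G}].$$
   Context: $\Delta^{\mathcal{D}}$ is the set of distributions on $\mathcal{D}$; for $S\subseteq\mathcal{D}$, $\mathbf{f}_S(\mathbf{p})=\sum_{x\in S}\mathbf{g}(\mathbf{p}_x)$. For $y^n\in\mathcal{D}^n$, $\mathbf{f}(y^n,x)=|\{i:y^n_i=x\}|$ and $\mathbb{P}(\mathbf{p},y^n)=\prod_x\mathbf{p}_x^{\mathbf{f}(y^n,x)}$. The $S$-pseudo profile $\Phi_S(y^n)$ is $(\phi_S(j))_{j\in[n]}$ with $\phi_S(j)=|\{x\in S:\mathbf{f}(y^n,x)=j\}|$; $\Phi_S^n$ denotes the set of all $S$-pseudo profiles of length-$n$ sequences; $\mathbb{P}(\mathbf{p},\phi_S)=\sum_{y^n:\Phi_S(y^n)=\phi_S}\mathbb{P}(\mathbf{p},y^n)$. A $(\beta,S)$-approximate pseudo PML distribution for $\phi_S$ is any $\mathbf{q}\in\Delta^{\mathcal{D}}$ with $\mathbb{P}(\mathbf{q},\phi_S)\ge\beta\max_{\mathbf{q}'\in\Delta^{\mathcal{D}}}\mathbb{P}(\mathbf{q}',\phi_S)$. $\mathrm{Freq}(\phi_S)=\{j\in[n]:\phi_S(j)>0\}$. *)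

theory Defs
  imports "HOL-Probability.Probability"
begin

text \<open>The finite domain is a type \<open>'a :: finite\<close>, and the distributions on it are the elements of
  \<open>'a pmf\<close>.  A sequence of length \<open>n\<close> is a list; the frequency of \<open>x\<close> in \<open>y\<close> is \<open>count_list y x\<close>.\<close>

definition separable_on :: "(real \<Rightarrow> real) \<Rightarrow> 'a::finite set \<Rightarrow> 'a pmf \<Rightarrow> real" where
  "separable_on g S p = (\<Sum>x\<in>S. g (pmf p x))"

definition seq_prob :: "'a::finite pmf \<Rightarrow> 'a list \<Rightarrow> real" where
  "seq_prob p y = (\<Prod>x\<in>UNIV. pmf p x ^ count_list y x)"

text \<open>Frequency 0 is not recorded in a profile: its index set is \<open>{1..n}\<close>.\<close>

definition pseudo_profile :: "'a::finite set \<Rightarrow> 'a list \<Rightarrow> nat \<Rightarrow> nat" where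
  "pseudo_profile S y = (\<lambda>j\<in>{1..length y}. card {x\<in>S. count_list y x = j})"

definition pseudo_profiles :: "nat \<Rightarrow> 'a::finite set \<Rightarrow> (nat \<Rightarrow> nat) set" where
  "pseudo_profiles n S = pseudo_profile S ` {y. length y = n}"

definition profile_prob :: "nat \<Rightarrow> 'a::finite set \<Rightarrow> 'a pmf \<Rightarrow> (nat \<Rightarrow> nat) \<Rightarrow> real" where
  "profile_prob n S p \<phi> = (\<Sum>y | length y = n \<and> pseudo_profile S y = \<phi>. seq_prob p y)"

text \<open>The maximum over all distributions is attained (a continuous function on a compact simplex),
  so it is written as a supremum.\<close>

definition approx_pseudo_PML ::
    "nat \<Rightarrow> real \<Rightarrow> 'a::finite set \<Rightarrow> (nat \<Rightarrow> nat) \<Rightarrow> 'a pmf \<Rightarrow> bool" where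
  "approx_pseudo_PML n \<beta> S \<phi> q \<longleftrightarrow>
     \<phi> \<in> pseudo_profiles n S \<and>
     profile_prob n S q \<phi> \<ge> \<beta> * (SUP q'. profile_prob n S q' \<phi>)"

definition Freq :: "nat \<Rightarrow> (nat \<Rightarrow> nat) \<Rightarrow> nat set" where
  "Freq n \<phi> = {j\<in>{1..n}. \<phi> j > 0}"

definition freq_set :: "nat set \<Rightarrow> 'a::finite list \<Rightarrow> 'a set" where
  "freq_set F y = {x. count_list y x \<in> F}"

text \<open>\<open>a\<close> to the power of the cardinality of \<open>A\<close>, which is infinite if \<open>A\<close> is (recall that \<open>card A = 0\<close>
  for infinite \<open>A\<close>).\<close>

definition power_card :: "real \<Rightarrow> 'b set \<Rightarrow> ereal" where
  "power_card a A = (if finite A then ereal (a ^ card A) else \<infinity>)"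

end

theory Submission
  imports Defs
begin

text \<open>Condition on the first half of the sample, which fixes \<open>S\<close>. If \<open>S \<subseteq> G\<close> and a profile \<open>\<phi>\<close> has
  probability greater than \<open>\<delta> / \<beta>\<close> under \<open>p\<close>, then it has probability greater than \<open>\<delta>\<close> under \<open>p\<close> and
  under every \<open>\<beta>\<close>-approximate PML distribution \<open>q\<close> for \<open>\<phi>\<close>. The estimator therefore cannot fail on
  \<open>\<phi>\<close> for either distribution, and its value at \<open>\<phi>\<close> is within \<open>2\<epsilon>\<close> of both \<open>f\<^sub>S(p)\<close> and \<open>f\<^sub>S(q)\<close>.
  So every profile on which the plug-in fails has probability at most \<open>\<delta> / \<beta>\<close>, and at most
  \<open>(n + 1) ^ |F'|\<close> profiles have all their frequencies in \<open>F'\<close>.\<close>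

lemma pmf_replicate_pmf_eq_seq_prob:
  "pmf (replicate_pmf (length y) p) y = seq_prob p y"
proof (induction y)
  case Nil
  show ?case by (simp add: seq_prob_def)
next
  case (Cons a y)
  have "replicate_pmf (length (a # y)) p =
      map_pmf (\<lambda>(x, xs). x # xs) (pair_pmf p (replicate_pmf (length y) p))"
    by (simp add: pair_pmf_def map_pmf_def bind_assoc_pmf bind_return_pmf)
  moreover have "pmf (map_pmf (\<lambda>(x, xs). x # xs) (pair_pmf p (replicate_pmf (length y) p)))
      ((\<lambda>(x, xs). x # xs) (a, y)) = pmf (pair_pmf p (replicate_pmf (length y) p)) (a, y)"
    by (rule pmf_map_inj') (auto simp: inj_on_def)
  ultimately have "pmf (replicate_pmf (length (a # y)) p) (a # y) = pmf p a * seq_prob p y"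
    using Cons by (simp add: pmf_pair)
  also have "pmf p a * seq_prob p y =
      (\<Prod>x\<in>UNIV. (if x = a then pmf p x else 1) * pmf p x ^ count_list y x)"
    by (simp add: seq_prob_def prod.distrib)
  also have "\<dots> = seq_prob p (a # y)"
    unfolding seq_prob_def by (intro prod.cong) auto
  finally show ?case .
qed

text \<open>Lists of any other length lie outside the support of \<open>replicate_pmf n p\<close>,
  so the event may drop the length condition that the sum carries.\<close>

lemma profile_prob_eq_prob:
  "profile_prob n S p \<phi> = measure_pmf.prob (replicate_pmf n p) {y. pseudo_profile S y = \<phi>}"
proof -
  let ?A = "{y. length y = n \<and> pseudo_profile S y = \<phi>}"
  have "finite {y :: 'a list. length y = n}"
    using finite_lists_length_eq[of "UNIV :: 'a set" n] by simp
  then have fin: "finite ?A"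
    by (rule rev_finite_subset) auto
  have "measure_pmf.prob (replicate_pmf n p) {y. pseudo_profile S y = \<phi>} =
      measure_pmf.prob (replicate_pmf n p) ?A"
    by (rule measure_prob_cong_0) (auto simp: set_pmf_iff[symmetric] set_replicate_pmf pmf_eq_0_set_pmf)
  also have "\<dots> = (\<Sum>y\<in>?A. pmf (replicate_pmf n p) y)"
    by (rule measure_measure_pmf_finite[OF fin])
  also have "\<dots> = profile_prob n S p \<phi>"
    unfolding profile_prob_def
    by (intro sum.cong) (auto simp: pmf_replicate_pmf_eq_seq_prob[symmetric])
  finally show ?thesis ..
qed

lemma approx_pseudo_PML_ge:
  assumes "approx_pseudo_PML n \<beta> S \<phi> q" and "0 \<le> \<beta>"
  shows "\<beta> * profile_prob n S p \<phi> \<le> profile_prob n S q \<phi>"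
proof -
  \<comment> \<open>Boundedness by 1 is what makes the real-valued \<open>SUP\<close> an upper bound
    for its family.\<close>
  have "bdd_above (range (\<lambda>q'. profile_prob n S q' \<phi>))"
    by (intro bdd_aboveI[of _ 1]) (auto simp: profile_prob_eq_prob)
  then have "profile_prob n S p \<phi> \<le> (SUP q'. profile_prob n S q' \<phi>)"
    by (intro cSUP_upper) auto
  then show ?thesis
    using assms unfolding approx_pseudo_PML_def by (meson mult_left_mono order_trans)
qed

lemma pseudo_profile_le_length:
  assumes "j \<in> {1..length y}"
  shows "pseudo_profile S y j \<le> length y"
proof -
  \<comment> \<open>As \<open>j\<close> is at least 1, every symbol counted here occurs in
    \<open>y\<close>.\<close>
  have "{x \<in> S. count_list y x = j} \<subseteq> set y"
    using assms by (auto simp: count_list_0_iff[symmetric] intro: ccontr)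
  then have "card {x \<in> S. count_list y x = j} \<le> card (set y)"
    by (intro card_mono) auto
  also have "\<dots> \<le> length y" by (rule card_length)
  finally show ?thesis using assms by (simp add: pseudo_profile_def)
qed

text \<open>Such a profile is determined by its values on \<open>F' \<inter> {1..n}\<close>: it is 0
  on the rest of \<open>{1..n}\<close> and \<open>undefined\<close> elsewhere. Each of these values
  is one of the n + 1 numbers 0, ..., n.\<close>

lemma card_profiles_Freq_le:
  fixes S :: "'a::finite set"
  shows "finite {\<phi> \<in> pseudo_profiles n S. Freq n \<phi> \<subseteq> F'}"
    and "card {\<phi> \<in> pseudo_profiles n S. Freq n \<phi> \<subseteq> F'} \<le> (n + 1) ^ card (F' \<inter> {1..n})"
proof -
  let ?P = "{\<phi> \<in> pseudo_profiles n S. Freq n \<phi> \<subseteq> F'}"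
  let ?E = "(F' \<inter> {1..n}) \<rightarrow>\<^sub>E {0..n}"
  let ?r = "\<lambda>\<phi> :: nat \<Rightarrow> nat. restrict \<phi> (F' \<inter> {1..n})"
  have inj: "inj_on ?r ?P"
  proof (rule inj_onI)
    fix \<phi> \<psi> assume *: "\<phi> \<in> ?P" "\<psi> \<in> ?P" "?r \<phi> = ?r \<psi>"
    show "\<phi> = \<psi>"
    proof
      fix j
      consider "j \<notin> {1..n}" | "j \<in> F' \<inter> {1..n}" | "j \<in> {1..n}" "j \<notin> F'" by blast
      then show "\<phi> j = \<psi> j"
      proof cases
        case 1
        then show ?thesis using * by (auto simp: pseudo_profiles_def pseudo_profile_def)
      next
        case 2
        then show ?thesis using fun_cong[OF *(3), of j] by simp
      next
        case 3
        then have "\<phi> j = 0" "\<psi> j = 0" using * by (auto simp: Freq_def)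
        then show ?thesis by simp
      qed
    qed
  qed
  have sub: "?r ` ?P \<subseteq> ?E"
  proof (intro image_subsetI restrict_PiE_iff[THEN iffD2] ballI)
    fix \<phi> j assume "\<phi> \<in> ?P" "j \<in> F' \<inter> {1..n}"
    then show "\<phi> j \<in> {0..n}"
      using pseudo_profile_le_length[of j] by (auto simp: pseudo_profiles_def)
  qed
  have fin: "finite ?E" by (intro finite_PiE) auto
  show "finite ?P" using inj_on_finite[OF inj sub fin] .
  have "card ?P \<le> card ?E" by (rule card_inj_on_le[OF inj sub fin])
  also have "card ?E = (n + 1) ^ card (F' \<inter> {1..n})" by (simp add: card_funcsetE)
  finally show "card ?P \<le> (n + 1) ^ card (F' \<inter> {1..n})" .
qed

text \<open>The estimator sees \<open>y\<close> only through its profile. If it erred at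
  \<open>\<phi>\<close>, it would err on every sequence with that profile, an event of probability
  above \<open>\<delta>\<close>.\<close>

lemma estimator_accurate_at_likely_profile:
  assumes "measure_pmf.prob (replicate_pmf n p)
             {y. \<bar>separable_on g S p - fhat (pseudo_profile S y)\<bar> \<ge> t} \<le> \<delta>"
    and "\<delta> < profile_prob n S p \<phi>"
  shows "\<bar>separable_on g S p - fhat \<phi>\<bar> < t"
proof (rule ccontr)
  assume "\<not> ?thesis"
  then have "{y. pseudo_profile S y = \<phi>} \<subseteq>
      {y. \<bar>separable_on g S p - fhat (pseudo_profile S y)\<bar> \<ge> t}" by auto
  then have "profile_prob n S p \<phi> \<le> measure_pmf.prob (replicate_pmf n p)
             {y. \<bar>separable_on g S p - fhat (pseudo_profile S y)\<bar> \<ge> t}"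
    unfolding profile_prob_eq_prob by (intro measure_pmf.finite_measure_mono) auto
  with assms show False by simp
qed

lemma approx_pseudo_PML_failure_prob:
  fixes q :: "'a::finite list \<Rightarrow> 'a pmf"
  assumes "0 \<le> \<delta>" and "0 < \<beta>" and "\<beta> \<le> 1"
    and est: "\<And>p'. measure_pmf.prob (replicate_pmf n p')
          {y. \<bar>separable_on g S p' - fhat (pseudo_profile S y)\<bar> \<ge> 2 * \<epsilon>} \<le> \<delta>"
    and freq: "measure_pmf.prob (replicate_pmf n p)
          {y. \<not> Freq n (pseudo_profile S y) \<subseteq> F'} \<le> \<gamma>"
    and PML: "\<And>y. length y = n \<Longrightarrow> approx_pseudo_PML n \<beta> S (pseudo_profile S y) (q y)"
  shows "measure_pmf.prob (replicate_pmf n p)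
          {y. \<bar>separable_on g S p - separable_on g S (q y)\<bar> > 4 * \<epsilon>}
        \<le> \<delta> * (real n + 1) ^ card (F' \<inter> {1..n}) / \<beta> + \<gamma>"
proof -
  let ?M = "replicate_pmf n p"
  let ?bad = "\<lambda>y. \<bar>separable_on g S p - separable_on g S (q y)\<bar> > 4 * \<epsilon>"
  define B where "B = {y. length y = n \<and> ?bad y \<and> Freq n (pseudo_profile S y) \<subseteq> F'}"
  \<comment> \<open>\<open>q\<close> may differ between sequences with the same profile. One bad
    sequence puts its profile into \<open>P\<close>, and the whole event of that profile is then
    charged.\<close>
  define P where "P = pseudo_profile S ` B"
  have P_sub: "P \<subseteq> {\<phi> \<in> pseudo_profiles n S. Freq n \<phi> \<subseteq> F'}"
    by (auto simp: P_def B_def pseudo_profiles_def)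
  then have fin_P: "finite P" by (rule finite_subset) (rule card_profiles_Freq_le)
  have "card P \<le> (n + 1) ^ card (F' \<inter> {1..n})"
    using card_mono[OF card_profiles_Freq_le(1) P_sub] card_profiles_Freq_le(2) by (rule order_trans)
  then have card_P: "real (card P) \<le> (real n + 1) ^ card (F' \<inter> {1..n})"
    by (metis of_nat_1 of_nat_add of_nat_le_iff of_nat_power)
  have prob_le: "profile_prob n S p \<phi> \<le> \<delta> / \<beta>" if "\<phi> \<in> P" for \<phi>
  proof (rule ccontr)
    assume "\<not> ?thesis"
    then have *: "\<delta> < \<beta> * profile_prob n S p \<phi>"
      using \<open>0 < \<beta>\<close> by (simp add: field_simps)
    obtain y where y: "length y = n" "?bad y" "\<phi> = pseudo_profile S y"
      using \<open>\<phi> \<in> P\<close> by (auto simp: P_def B_def)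
    have "\<beta> * profile_prob n S p \<phi> \<le> profile_prob n S p \<phi>"
      using \<open>\<beta> \<le> 1\<close> by (intro mult_left_le_one_le) (auto simp: profile_prob_eq_prob \<open>0 < \<beta>\<close> less_imp_le)
    with * have "\<bar>separable_on g S p - fhat \<phi>\<bar> < 2 * \<epsilon>"
      by (intro estimator_accurate_at_likely_profile[OF est]) simp
    \<comment> \<open>The witness \<open>y\<close> is fixed here, so \<open>q y\<close> is a single
      distribution and \<open>est\<close> applies to it.\<close>
    moreover have "\<beta> * profile_prob n S p \<phi> \<le> profile_prob n S (q y) \<phi>"
      using approx_pseudo_PML_ge[OF PML[OF y(1)]] \<open>0 < \<beta>\<close> y(3) by simp
    with * have "\<bar>separable_on g S (q y) - fhat \<phi>\<bar> < 2 * \<epsilon>"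
      by (intro estimator_accurate_at_likely_profile[OF est]) simp
    ultimately show False using y(2) by linarith
  qed
  have "measure_pmf.prob ?M {y. ?bad y} = measure_pmf.prob ?M {y. length y = n \<and> ?bad y}"
    by (rule measure_prob_cong_0) (auto simp: set_replicate_pmf pmf_eq_0_set_pmf)
  \<comment> \<open>A bad sequence with all its frequencies in \<open>F'\<close> lies in
    \<open>B\<close>, so its profile is in \<open>P\<close>; the others fall under the second event,
    which costs \<open>\<gamma>\<close>.\<close>
  also have "\<dots> \<le> measure_pmf.prob ?M
      ((\<Union>\<phi>\<in>P. {y. pseudo_profile S y = \<phi>}) \<union> {y. \<not> Freq n (pseudo_profile S y) \<subseteq> F'})"
    by (intro measure_pmf.finite_measure_mono) (auto simp: P_def B_def)
  also have "\<dots> \<le> measure_pmf.prob ?M (\<Union>\<phi>\<in>P. {y. pseudo_profile S y = \<phi>}) + \<gamma>"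
    by (rule order_trans[OF measure_Un_le add_left_mono[OF freq]]) auto
  also have "measure_pmf.prob ?M (\<Union>\<phi>\<in>P. {y. pseudo_profile S y = \<phi>}) \<le>
      (\<Sum>\<phi>\<in>P. measure_pmf.prob ?M {y. pseudo_profile S y = \<phi>})"
    by (rule measure_pmf.finite_measure_subadditive_finite[OF fin_P]) auto
  also have "\<dots> \<le> (\<Sum>\<phi>\<in>P. \<delta> / \<beta>)"
    using prob_le by (intro sum_mono) (simp add: profile_prob_eq_prob)
  also have "\<dots> \<le> (real n + 1) ^ card (F' \<inter> {1..n}) * (\<delta> / \<beta>)"
    using card_P \<open>0 \<le> \<delta>\<close> \<open>0 < \<beta>\<close> by (simp only: sum_constant) (intro mult_right_mono, auto)
  finally show ?thesis by (simp add: mult_ac)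
qed

text \<open>This serves to condition on the first half of the sample: a bound valid for each of its
  outcomes survives averaging.\<close>

lemma prob_bind_pmf_le:
  assumes "\<And>x. x \<in> set_pmf M \<Longrightarrow> measure_pmf.prob (N x) X \<le> c" and "0 \<le> c"
  shows "measure_pmf.prob (bind_pmf M N) X \<le> c"
proof -
  have "emeasure (bind_pmf M N) X \<le> (\<integral>\<^sup>+x. ennreal c \<partial>M)"
    unfolding emeasure_bind_pmf using assms
    by (intro nn_integral_mono_AE AE_pmfI) (simp add: measure_pmf.emeasure_eq_measure ennreal_leI)
  then show ?thesis
    using \<open>0 \<le> c\<close> by (simp add: measure_pmf.emeasure_eq_measure measure_pmf.emeasure_space_1)
qed

text \<open>The count of profiles involves only frequencies in \<open>{1..n}\<close>. This passes
  from that truncated exponent to all of \<open>F'\<close>, be it finite or infinite.\<close>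

lemma power_card_ge:
  assumes "1 \<le> a"
  shows "ereal (a ^ card (A \<inter> B)) \<le> power_card a A"
  using assms by (auto simp: power_card_def intro!: power_increasing card_mono)

theorem theorem4:
  fixes g :: "real \<Rightarrow> real"
    and G :: "'a::finite set"
    and F F' :: "nat set"
    and n :: nat
    and \<epsilon> \<delta> \<gamma> \<beta> :: real
    and p :: "'a pmf"
    and q :: "'a list \<Rightarrow> 'a pmf"
  assumes "\<epsilon> > 0" and "\<delta> \<ge> 0" and "\<gamma> \<ge> 0" and "0 < \<beta>" and "\<beta> \<le> 1"
    and estimator: "\<And>S'. S' \<subseteq> G \<Longrightarrow>
      \<exists>fhat :: (nat \<Rightarrow> nat) \<Rightarrow> real. \<forall>p' :: 'a pmf.
        measure_pmf.prob (replicate_pmf n p')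
          {y. \<bar>separable_on g S' p' - fhat (pseudo_profile S' y)\<bar> \<ge> 2 * \<epsilon>} \<le> \<delta> \<and>
        measure_pmf.prob (replicate_pmf n p')
          {y. \<not> Freq n (pseudo_profile S' y) \<subseteq> F'} \<le> \<gamma>"
    and PML: "\<And>x. length x = 2 * n \<Longrightarrow>
      approx_pseudo_PML n \<beta> (freq_set F (take n x))
        (pseudo_profile (freq_set F (take n x)) (drop n x)) (q x)"
  shows "ereal (measure_pmf.prob (replicate_pmf (2 * n) p)
            {x. \<bar>separable_on g (freq_set F (take n x)) p
                 - separable_on g (freq_set F (take n x)) (q x)\<bar> > 4 * \<epsilon>})
         \<le> ereal \<delta> * power_card (real n + 1) F' / ereal \<beta> + ereal \<gamma>
           + ereal (measure_pmf.prob (replicate_pmf (2 * n) p)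
               {x. \<not> freq_set F (take n x) \<subseteq> G})"
proof -
  let ?M = "replicate_pmf (2 * n) p"
  let ?S = "\<lambda>x. freq_set F (take n x)"
  let ?bad = "{x. \<bar>separable_on g (?S x) p - separable_on g (?S x) (q x)\<bar> > 4 * \<epsilon>}"
  let ?out = "{x. \<not> ?S x \<subseteq> G}"
  define k where "k = (real n + 1) ^ card (F' \<inter> {1..n})"
  define c where "c = \<delta> * k / \<beta> + \<gamma>"
  have "0 \<le> c" using assms(2-4) by (simp add: c_def k_def)
  have split: "?M = bind_pmf (replicate_pmf n p)
      (\<lambda>xs. map_pmf (\<lambda>ys. xs @ ys) (replicate_pmf n p))"
    using replicate_pmf_distrib[of n n p] by (simp add: mult_2 map_pmf_def)
  \<comment> \<open>An estimator is available only for subsets of \<open>G\<close>, so the outcomes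
    in \<open>?out\<close> are set aside; they return as the last term of the bound.\<close>
  have "measure_pmf.prob ?M (?bad - ?out) \<le> c"
    unfolding split
  proof (rule prob_bind_pmf_le[OF _ \<open>0 \<le> c\<close>])
    fix xs assume "xs \<in> set_pmf (replicate_pmf n p)"
    then have len: "length xs = n" by (simp add: set_replicate_pmf)
    define S where "S = freq_set F xs"
    show "measure_pmf.prob (map_pmf (\<lambda>ys. xs @ ys) (replicate_pmf n p)) (?bad - ?out) \<le> c"
    proof (cases "S \<subseteq> G")
      case False
      \<comment> \<open>Membership in \<open>?out\<close> is decided by the first half, so every
        continuation of this \<open>xs\<close> of the sampled length has been set aside.\<close>
      then have "(\<lambda>ys. xs @ ys) -` (?bad - ?out) = {}"
        by (auto simp: S_def len)
      then show ?thesis using \<open>0 \<le> c\<close> by simp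
    next
      case True
      then obtain fhat where fhat: "\<And>p' :: 'a pmf.
          measure_pmf.prob (replicate_pmf n p')
            {y. \<bar>separable_on g S p' - fhat (pseudo_profile S y)\<bar> \<ge> 2 * \<epsilon>} \<le> \<delta>"
          "\<And>p' :: 'a pmf. measure_pmf.prob (replicate_pmf n p')
            {y. \<not> Freq n (pseudo_profile S y) \<subseteq> F'} \<le> \<gamma>"
        using estimator[OF True] by (elim exE) blast
      have "(\<lambda>ys. xs @ ys) -` (?bad - ?out) =
          {y. \<bar>separable_on g S p - separable_on g S (q (xs @ y))\<bar> > 4 * \<epsilon>}"
        using True by (auto simp: S_def len)
      moreover have "measure_pmf.prob (replicate_pmf n p)
          {y. \<bar>separable_on g S p - separable_on g S (q (xs @ y))\<bar> > 4 * \<epsilon>} \<le> c"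
        unfolding c_def k_def
      \<comment> \<open>With \<open>xs\<close> fixed, \<open>S\<close> is constant and the chosen
        distribution is a function of the second half alone.\<close>
      proof (rule approx_pseudo_PML_failure_prob[OF assms(2,4,5) fhat])
        fix y :: "'a list" assume "length y = n"
        then show "approx_pseudo_PML n \<beta> S (pseudo_profile S y) (q (xs @ y))"
          using PML[of "xs @ y"] by (simp add: S_def len)
      qed
      ultimately show ?thesis by simp
    qed
  qed
  moreover have "measure_pmf.prob ?M ?bad \<le>
      measure_pmf.prob ?M (?bad - ?out) + measure_pmf.prob ?M ?out"
    by (rule order_trans[OF measure_pmf.finite_measure_mono measure_Un_le])
       auto
  ultimately have "ereal (measure_pmf.prob ?M ?bad) \<le>
      ereal (\<delta> * k / \<beta>) + ereal \<gamma> + ereal (measure_pmf.prob ?M ?out)"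
    by (simp add: c_def)
  moreover have "ereal (\<delta> * k / \<beta>) \<le> ereal \<delta> * power_card (real n + 1) F' / ereal \<beta>"
  proof -
    \<comment> \<open>For \<open>\<delta> = 0\<close> and infinite \<open>F'\<close> the right side
      is 0 times \<infinity>, which is 0 in \<open>ereal\<close>; the left side is 0 as
      well.\<close>
    have "ereal \<delta> * ereal k \<le> ereal \<delta> * power_card (real n + 1) F'"
      unfolding k_def using \<open>0 \<le> \<delta>\<close> by (intro ereal_mult_left_mono power_card_ge) auto
    then have "ereal \<delta> * ereal k / ereal \<beta> \<le> ereal \<delta> * power_card (real n + 1) F' / ereal \<beta>"
      using \<open>0 < \<beta>\<close> by (intro ereal_divide_right_mono) auto
    then show ?thesis using \<open>0 < \<beta>\<close> by simp
  qed
  ultimately show ?thesis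
    by (meson add_right_mono order_trans)
qed

end
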